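(* Let $D\ge3$ and $n\ge3$, let $\Gamma=(X,\mathcal{R})$ be the Hamming graph $H(D,n)$, and fix $x\in X$. Then $$-\tfrac12RL^2+LRL-\tfrac12L^2R=(n-1)L$$ holds on $E_i^*V$ for every $1\le i\le D$. In particular, $\Gamma$ supports a strongly uniform structure with respect to $x$, with $e_i^-=-\frac12$ ($2\le i\le D$), $e_i^+=-\frac12$ ($1\le i\le D-1$), and $f_i=n-1$ ($1\le i\le D$).
   Context: Hamming graph $H(D,n)$: vertices are the $D$-tuples over an $n$-element alphabet, adjacent iff they differ in exactly one coordinate; its diameter is $D$. With distance $\partial$: $V=\mathbb{C}^X$, $A$ the adjacency matrix, $E_i^*$ the diagonal $0/1$ matrix with $(y,y)$-entry $1$ iff $\partial(x,y)=i$; $L=\sum_{i=1}^{D}E^*_{i-1}AE^*_i$, $R=\sum_{i=0}^{D-1}E^*_{i+1}AE^*_i=L^\top$. $\Gamma_f$ is the graph on $X$ whose edges are the edges $yz$ of $\Gamma$ with $\partial(x,y)\ne\partial(x,z)$ (bipartite with lowering/raising matrices $L,R$). A parameter matrix is a tridiagonal complex $U=(e_{ij})_{1\le i,j\le D}$ with $e_{ii}=1$, with $e_{i,i-1}\ne0$ for all $2\le i\le D$ or $e_{i-1,i}\ne0$ for all $2\le i\le D$, and every principal submatrix $(e_{ij})_{s\le i,j\le t}$ nonsingular; $e_i^-=e_{i,i-1}$, $e_i^+=e_{i,i+1}$, $e_1^-=e_D^+=0$. A uniform structure of $\Gamma_f$ w.r.t. $x$ is a pair $(U,f)$, $f\in\mathbb{C}^D$,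 with $e_i^-RL^2+LRL+e_i^+L^2R=f_iL$ on $E_i^*V$ for all $1\le i\le D$; strongly uniform if all $e_i^-$ ($2\le i\le D$) and $e_i^+$ ($1\le i\le D-1$) are nonzero. $\Gamma$ supports a strongly uniform structure w.r.t. $x$ if $\Gamma_f$ admits one. *)

theory Defs
  imports "HOL-Analysis.Analysis" "Jordan_Normal_Form.Determinant"
begin

text \<open>A graph on a finite vertex type is given by its adjacency predicate.  The matrices indexed
  by vertices, and the standard module, use the type-indexed matrices and vectors of
  HOL-Analysis; the library of Jordan normal forms is only used for determinants of square
  matrices of varying size.\<close>

type_synonym 'v graph = "'v \<Rightarrow> 'v \<Rightarrow> bool"
type_synonym 'v cmatrix = "complex ^ 'v ^ 'v"

text \<open>Length of a shortest walk; only meaningful for vertices in the same connected component.\<close>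

definition gdist :: "'v graph \<Rightarrow> 'v \<Rightarrow> 'v \<Rightarrow> nat" where
  "gdist G y z = (LEAST k. (G ^^ k) y z)"

definition gdiam :: "('v::finite) graph \<Rightarrow> nat" where
  "gdiam G = Max {gdist G y z | y z. True}"

definition hamming_graph :: "('d::finite \<Rightarrow> 'a) graph" where
  "hamming_graph y z \<longleftrightarrow> card {c. y c \<noteq> z c} = 1"

definition adjacency_matrix :: "('v::finite) graph \<Rightarrow> 'v cmatrix" where
  "adjacency_matrix G = (\<chi> y z. if G y z then 1 else 0)"

definition Estar :: "('v::finite) graph \<Rightarrow> 'v \<Rightarrow> nat \<Rightarrow> 'v cmatrix" where
  "Estar G x i = (\<chi> y z. if y = z \<and> gdist G x y = i then 1 else 0)"

definition EstarV :: "('v::finite) graph \<Rightarrow> 'v \<Rightarrow> nat \<Rightarrow> (complex ^ 'v) set" where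
  "EstarV G x i = range (\<lambda>v. Estar G x i *v v)"

definition lowering :: "nat \<Rightarrow> ('v::finite) graph \<Rightarrow> 'v \<Rightarrow> 'v cmatrix" where
  "lowering D G x = (\<Sum>i=1..D. Estar G x (i - 1) ** adjacency_matrix G ** Estar G x i)"

definition raising :: "nat \<Rightarrow> ('v::finite) graph \<Rightarrow> 'v \<Rightarrow> 'v cmatrix" where
  "raising D G x = (\<Sum>i=0..<D. Estar G x (i + 1) ** adjacency_matrix G ** Estar G x i)"

definition graph_f :: "'v graph \<Rightarrow> 'v \<Rightarrow> 'v graph" where
  "graph_f G x y z \<longleftrightarrow> G y z \<and> gdist G x y \<noteq> gdist G x z"

text \<open>A \<open>D \<times> D\<close> matrix with rows and columns indexed by \<open>1, \<dots>, D\<close> is a function of which only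
  the values at these indices are used.  The function \<open>principal_submatrix\<close> moves the index
  range \<open>s, \<dots>, t\<close> to \<open>0, \<dots>, t - s\<close>.\<close>

definition principal_submatrix ::
  "(nat \<Rightarrow> nat \<Rightarrow> complex) \<Rightarrow> nat \<Rightarrow> nat \<Rightarrow> complex Matrix.mat" where
  "principal_submatrix U s t =
     Matrix.mat (t + 1 - s) (t + 1 - s) (\<lambda>(i, j). U (s + i) (s + j))"

definition parameter_matrix :: "nat \<Rightarrow> (nat \<Rightarrow> nat \<Rightarrow> complex) \<Rightarrow> bool" where
  "parameter_matrix D U \<longleftrightarrow>
     (\<forall>i\<in>{1..D}. \<forall>j\<in>{1..D}. i + 1 < j \<or> j + 1 < i \<longrightarrow> U i j = 0) \<and>
     (\<forall>i\<in>{1..D}. U i i = 1) \<and>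
     ((\<forall>i\<in>{2..D}. U i (i - 1) \<noteq> 0) \<or> (\<forall>i\<in>{2..D}. U (i - 1) i \<noteq> 0)) \<and>
     (\<forall>s t. 1 \<le> s \<and> s \<le> t \<and> t \<le> D \<longrightarrow> Determinant.det (principal_submatrix U s t) \<noteq> 0)"

definition e_minus :: "(nat \<Rightarrow> nat \<Rightarrow> complex) \<Rightarrow> nat \<Rightarrow> complex" where
  "e_minus U i = (if i = 1 then 0 else U i (i - 1))"

definition e_plus :: "nat \<Rightarrow> (nat \<Rightarrow> nat \<Rightarrow> complex) \<Rightarrow> nat \<Rightarrow> complex" where
  "e_plus D U i = (if i = D then 0 else U i (i + 1))"

text \<open>The pair \<open>(U, f)\<close> is a uniform structure of \<open>graph_f G x\<close> with respect to \<open>x\<close>, where \<open>D\<close>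
  is the diameter of \<open>G\<close> itself (that of \<open>graph_f G x\<close> may be larger).  The matrices \<open>L\<close>, \<open>R\<close>
  and the subspaces are those of \<open>graph_f G x\<close>; for connected \<open>G\<close> they coincide with those of
  \<open>G\<close>, as both graphs have the same distances from \<open>x\<close> and the same edges between vertices at
  different distances from \<open>x\<close>.\<close>

definition uniform_structure ::
  "('v::finite) graph \<Rightarrow> 'v \<Rightarrow> (nat \<Rightarrow> nat \<Rightarrow> complex) \<Rightarrow> (nat \<Rightarrow> complex) \<Rightarrow> bool" where
  "uniform_structure G x U f \<longleftrightarrow>
     (let D = gdiam G; L = lowering D (graph_f G x) x; R = raising D (graph_f G x) x in
        parameter_matrix D U \<and>
        (\<forall>i\<in>{1..D}. \<forall>v\<in>EstarV (graph_f G x) x i.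
           e_minus U i *s ((R ** L ** L) *v v) + (L ** R ** L) *v v
             + e_plus D U i *s ((L ** L ** R) *v v) = f i *s (L *v v)))"

definition strongly_uniform_structure ::
  "('v::finite) graph \<Rightarrow> 'v \<Rightarrow> (nat \<Rightarrow> nat \<Rightarrow> complex) \<Rightarrow> (nat \<Rightarrow> complex) \<Rightarrow> bool" where
  "strongly_uniform_structure G x U f \<longleftrightarrow>
     uniform_structure G x U f \<and>
     (\<forall>i\<in>{2..gdiam G}. e_minus U i \<noteq> 0) \<and>
     (\<forall>i\<in>{1..gdiam G - 1}. e_plus (gdiam G) U i \<noteq> 0)"

definition supports_strongly_uniform :: "('v::finite) graph \<Rightarrow> 'v \<Rightarrow> bool" where
  "supports_strongly_uniform G x \<longleftrightarrow> (\<exists>U f. strongly_uniform_structure G x U f)"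

end

theory Submission
  imports Defs
begin

text \<open>Lowering and raising act one coordinate at a time: \<open>L = \<Sum>\<^sub>c l\<^sub>c\<close> and \<open>R = \<Sum>\<^sub>c r\<^sub>c\<close>, where operators
  at different coordinates commute, \<open>l\<^sub>c l\<^sub>c = 0\<close> and \<open>l\<^sub>c r\<^sub>c l\<^sub>c = (n - 1) l\<^sub>c\<close>.  Hence
  \<open>[L, [L, R]] = \<Sum>\<^sub>c [l\<^sub>c, [l\<^sub>c, r\<^sub>c]] = - 2 (n - 1) L\<close>, which is the claimed identity times \<open>- 2\<close>.\<close>

no_notation Matrix.vec_index (infixl "$" 100)

section \<open>Distances\<close>

definition hdist :: "('d::finite \<Rightarrow> 'a) \<Rightarrow> ('d \<Rightarrow> 'a) \<Rightarrow> nat" where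
  "hdist y z = card {c. y c \<noteq> z c}"

lemma hdist_le_card: "hdist y (z :: 'd::finite \<Rightarrow> 'a) \<le> CARD('d)"
  unfolding hdist_def by (intro card_mono) auto

lemma hdist_self [simp]: "hdist y y = 0"
  by (simp add: hdist_def)

lemma hdist_eq_0_iff: "hdist y z = 0 \<longleftrightarrow> y = z"
  by (auto simp: hdist_def fun_eq_iff)

lemma hdist_triangle: "hdist x z \<le> hdist x y + hdist y z"
proof -
  have "hdist x z \<le> card ({c. x c \<noteq> y c} \<union> {c. y c \<noteq> z c})"
    unfolding hdist_def by (intro card_mono) auto
  also have "\<dots> \<le> hdist x y + hdist y z"
    unfolding hdist_def by (rule card_Un_le)
  finally show ?thesis .
qed

lemma hdist_upd_eq_Suc:
  assumes "y c = x c" "a \<noteq> x c"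
  shows "hdist x (y(c := a)) = Suc (hdist x y)"
proof -
  have "{d. x d \<noteq> (y(c := a)) d} = insert c {d. x d \<noteq> y d}"
    using assms by auto
  then show ?thesis
    using assms by (simp add: hdist_def)
qed

lemma hdist_upd_self:
  assumes "y c \<noteq> x c"
  shows "hdist x y = Suc (hdist x (y(c := x c)))"
  using hdist_upd_eq_Suc[of "y(c := x c)" c x "y c"] assms by simp

lemma hdist_upd_le:
  assumes "y c \<noteq> x c"
  shows "hdist x (y(c := a)) \<le> hdist x y"
proof -
  have "{d. x d \<noteq> (y(c := a)) d} \<subseteq> {d. x d \<noteq> y d}"
    using assms by auto
  then show ?thesis
    unfolding hdist_def by (intro card_mono) auto
qed

lemma hdist_le_upd:
  assumes "a \<noteq> x c"
  shows "hdist x y \<le> hdist x (y(c := a))"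
  using hdist_upd_le[of "y(c := a)" c x "y c"] assms by simp

lemma hamming_graph_iff: "hamming_graph y z \<longleftrightarrow> (\<exists>c a. z = y(c := a) \<and> a \<noteq> y c)"
proof
  assume "hamming_graph y z"
  then obtain c where c: "{d. y d \<noteq> z d} = {c}"
    by (auto simp: hamming_graph_def card_1_singleton_iff)
  then have "z d = y d \<longleftrightarrow> d \<noteq> c" for d
    by (metis (mono_tags, lifting) mem_Collect_eq singleton_iff)
  then have "z = y(c := z c) \<and> z c \<noteq> y c"
    by (simp add: fun_eq_iff)
  then show "\<exists>c a. z = y(c := a) \<and> a \<noteq> y c" by blast
next
  assume "\<exists>c a. z = y(c := a) \<and> a \<noteq> y c"
  then obtain c a where "z = y(c := a)" "a \<noteq> y c" by blast
  then have "{d. y d \<noteq> z d} = {c}" by auto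
  then show "hamming_graph y z"
    by (simp add: hamming_graph_def)
qed

section \<open>Walks and the graph distance\<close>

lemma hdist_le_of_walk:
  assumes "\<And>y z. G y z \<Longrightarrow> hamming_graph y z"
  shows "(G ^^ k) y z \<Longrightarrow> hdist y z \<le> k"
proof (induction k arbitrary: z)
  case 0
  then show ?case by (simp add: hdist_eq_0_iff)
next
  case (Suc k)
  then obtain u where "(G ^^ k) y u" "G u z" by auto
  with Suc.IH have "hdist y u \<le> k" by blast
  moreover have "hdist u z = 1"
    using assms[OF \<open>G u z\<close>] by (simp add: hamming_graph_def hdist_def)
  ultimately show ?case
    using hdist_triangle[of y z u] by linarith
qed

text \<open>Starting at x, the differing coordinates are switched one at a time to the letters of y.
  Every edge of this walk moves one layer away from x, so the walk survives in any graph that keeps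
  the Hamming edges between different layers.\<close>

lemma walk_of_hdist:
  assumes "\<And>y z. hamming_graph y z \<Longrightarrow> hdist x y \<noteq> hdist x z \<Longrightarrow> G y z"
  shows "hdist x y = k \<Longrightarrow> (G ^^ k) x y"
proof (induction k arbitrary: y)
  case 0
  then show ?case by (simp add: hdist_eq_0_iff)
next
  case (Suc k)
  then have "x \<noteq> y" by auto
  then obtain c where c: "y c \<noteq> x c" unfolding fun_eq_iff by metis
  let ?u = "y(c := x c)"
  have k: "hdist x ?u = k"
    using Suc.prems hdist_upd_self[of y c x] c by simp
  have "hamming_graph ?u y"
    unfolding hamming_graph_iff by (rule exI[of _ c], rule exI[of _ "y c"]) (use c in auto)
  then have "G ?u y"
    using assms k Suc.prems by simp
  with Suc.IH[OF k] show ?case by (auto simp del: fun_upd_apply intro: relcomppI)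
qed

text \<open>Stated for every graph squeezed between the layer-changing Hamming edges and the full
  Hamming graph, so that one argument covers both \<open>hamming_graph\<close> and
  \<open>graph_f hamming_graph x\<close>.\<close>

lemma gdist_eq_hdist:
  assumes "\<And>y z. G y z \<Longrightarrow> hamming_graph y z"
    and "\<And>y z. hamming_graph y z \<Longrightarrow> hdist x y \<noteq> hdist x z \<Longrightarrow> G y z"
  shows "gdist G x y = hdist x y"
  unfolding gdist_def
proof (rule Least_equality)
  show "(G ^^ hdist x y) x y"
    using walk_of_hdist[of x G y] assms(2) by blast
  show "hdist x y \<le> k" if "(G ^^ k) x y" for k
    using hdist_le_of_walk[of G k x y] assms(1) that by blast
qed

lemma gdist_hamming_graph: "gdist hamming_graph x y = hdist x y"
  by (rule gdist_eq_hdist)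

lemma gdist_graph_f_hamming_graph: "gdist (graph_f hamming_graph x) x y = hdist x y"
  by (rule gdist_eq_hdist) (auto simp: graph_f_def gdist_hamming_graph)

lemma gdiam_hamming_graph:
  assumes "CARD('a::finite) \<ge> 2"
  shows "gdiam (hamming_graph :: ('d::finite \<Rightarrow> 'a) graph) = CARD('d)"
  unfolding gdiam_def
proof (rule Max_eqI)
  show "finite {gdist (hamming_graph :: ('d \<Rightarrow> 'a) graph) y z |y z. True}"
    by (rule finite_subset[of _ "{..CARD('d)}"])
       (auto simp: gdist_hamming_graph hdist_le_card)
  show "k \<le> CARD('d)"
    if "k \<in> {gdist (hamming_graph :: ('d \<Rightarrow> 'a) graph) y z |y z. True}" for k
    using that by (auto simp: gdist_hamming_graph hdist_le_card)
  \<comment> \<open>Constant tuples on two distinct letters differ in every coordinate, so the bound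
    is attained.\<close>
  have "\<not> CARD('a) \<le> Suc 0" using assms by simp
  then obtain a b :: 'a where "a \<noteq> b"
    by (auto simp: card_le_Suc0_iff_eq)
  then have "CARD('d) = gdist hamming_graph (\<lambda>_::'d. a) (\<lambda>_. b)"
    by (simp add: gdist_hamming_graph hdist_def)
  then show "CARD('d) \<in> {gdist (hamming_graph :: ('d \<Rightarrow> 'a) graph) y z |y z. True}"
    by blast
qed

section \<open>Lowering and raising\<close>

lemma Estar_mult_adjacency_mult_Estar:
  "(Estar G x i ** adjacency_matrix H ** Estar G x j) $ y $ z =
     (if gdist G x y = i \<and> H y z \<and> gdist G x z = j then 1 else 0)"
proof -
  have "(Estar G x i ** adjacency_matrix H) $ y $ w =
      (if gdist G x y = i \<and> H y w then 1 else 0)" for w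
  proof -
    have "(Estar G x i ** adjacency_matrix H) $ y $ w =
        (\<Sum>u\<in>UNIV. if u = y then (if gdist G x y = i \<and> H y w then 1 else 0) else 0)"
      unfolding matrix_matrix_mult_def Estar_def adjacency_matrix_def vec_lambda_beta
      by (intro sum.cong) auto
    then show ?thesis by simp
  qed
  then have "(Estar G x i ** adjacency_matrix H ** Estar G x j) $ y $ z =
      (\<Sum>u\<in>UNIV. if u = z then
         (if gdist G x y = i \<and> H y z \<and> gdist G x z = j then 1 else 0) else 0)"
    unfolding matrix_matrix_mult_def[of "Estar G x i ** adjacency_matrix H"]
      Estar_def[of G x j] vec_lambda_beta
    by (intro sum.cong) auto
  then show ?thesis by simp
qed

lemma lowering_nth:
  assumes "\<And>y. gdist G x y \<le> D"
  shows "lowering D G x $ y $ z =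
    (if G y z \<and> gdist G x z = Suc (gdist G x y) then 1 else 0)"
proof -
  have "lowering D G x $ y $ z =
      (\<Sum>i=1..D. if i = Suc (gdist G x y) then
         (if G y z \<and> gdist G x z = Suc (gdist G x y) then 1 else 0) else 0)"
    unfolding lowering_def sum_component Estar_mult_adjacency_mult_Estar
    by (intro sum.cong) auto
  \<comment> \<open>If the entry is 1, the only contributing index is \<open>gdist G x z\<close>,
    which is positive and at most D by the distance bound, so it lies in the range of
    summation.\<close>
  also have "\<dots> = (if G y z \<and> gdist G x z = Suc (gdist G x y) then 1 else 0)"
    using assms[of z] by auto
  finally show ?thesis .
qed

lemma raising_nth:
  assumes "\<And>y. gdist G x y \<le> D"
  shows "raising D G x $ y $ z =
    (if G y z \<and> gdist G x y = Suc (gdist G x z) then 1 else 0)"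
proof -
  have "raising D G x $ y $ z =
      (\<Sum>i=0..<D. if i = gdist G x z then
         (if G y z \<and> gdist G x y = Suc (gdist G x z) then 1 else 0) else 0)"
    unfolding raising_def sum_component Estar_mult_adjacency_mult_Estar
    by (intro sum.cong) auto
  also have "\<dots> = (if G y z \<and> gdist G x y = Suc (gdist G x z) then 1 else 0)"
    using assms[of y] by auto
  finally show ?thesis .
qed

lemma lowering_mult_nth:
  assumes "\<And>y. gdist G x y \<le> D"
  shows "(lowering D G x *v v) $ y = (\<Sum>z | G y z \<and> gdist G x z = Suc (gdist G x y). v $ z)"
  by (auto simp: matrix_vector_mult_def lowering_nth[OF assms] intro!: sum.mono_neutral_cong_right split: if_splits)

lemma raising_mult_nth:
  assumes "\<And>y. gdist G x y \<le> D"
  shows "(raising D G x *v v) $ y = (\<Sum>z | G y z \<and> gdist G x y = Suc (gdist G x z). v $ z)"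
  by (auto simp: matrix_vector_mult_def raising_nth[OF assms] intro!: sum.mono_neutral_cong_right split: if_splits)

lemma nth_eq_0_of_EstarV:
  assumes "v \<in> EstarV G x i" "gdist G x y \<noteq> i"
  shows "v $ y = 0"
proof -
  obtain w where "v = Estar G x i *v w"
    using assms(1) by (auto simp: EstarV_def)
  then show ?thesis
    using assms(2) by (auto simp: matrix_vector_mult_def Estar_def intro!: sum.neutral)
qed

text \<open>There is no layer two steps below the first. This reconciles the convention that
  \<open>e_minus\<close> is 0 at index 1 with the coefficient -1/2 of the general identity.\<close>

lemma lowering_lowering_EstarV_1:
  assumes "\<And>y. gdist G x y \<le> D" "v \<in> EstarV G x 1"
  shows "lowering D G x *v (lowering D G x *v v) = 0"
  unfolding Finite_Cartesian_Product.vec_eq_iff lowering_mult_nth[OF assms(1)]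
  by (auto intro!: sum.neutral nth_eq_0_of_EstarV[OF assms(2)])

text \<open>The counterpart at the other end: it makes the convention that \<open>e_plus\<close> is
  0 at index D harmless.\<close>

lemma raising_EstarV_top:
  assumes "\<And>y. gdist G x y \<le> D" "v \<in> EstarV G x D"
  shows "raising D G x *v v = 0"
proof -
  have "v $ z = 0" if "gdist G x y = Suc (gdist G x z)" for y z
    using nth_eq_0_of_EstarV[OF assms(2), of z] assms(1)[of y] that by fastforce
  then show ?thesis
    unfolding Finite_Cartesian_Product.vec_eq_iff raising_mult_nth[OF assms(1)] by (auto intro!: sum.neutral)
qed

text \<open>Passing to \<open>graph_f\<close> deletes only edges inside a layer and keeps all
  distances from x, while the entries of L and R see only edges between consecutive layers.\<close>

lemma lowering_graph_f_hamming_graph: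
  fixes x :: "'d::finite \<Rightarrow> 'a::finite"
  shows "lowering CARD('d) (graph_f hamming_graph x) x = lowering CARD('d) hamming_graph x"
  by (auto simp: Finite_Cartesian_Product.vec_eq_iff lowering_nth gdist_hamming_graph gdist_graph_f_hamming_graph
      hdist_le_card graph_f_def)

lemma raising_graph_f_hamming_graph:
  fixes x :: "'d::finite \<Rightarrow> 'a::finite"
  shows "raising CARD('d) (graph_f hamming_graph x) x = raising CARD('d) hamming_graph x"
  by (auto simp: Finite_Cartesian_Product.vec_eq_iff raising_nth gdist_hamming_graph gdist_graph_f_hamming_graph
      hdist_le_card graph_f_def)

lemma EstarV_graph_f_hamming_graph:
  "EstarV (graph_f hamming_graph x) x i = EstarV hamming_graph x i"
  by (simp add: EstarV_def Estar_def gdist_hamming_graph gdist_graph_f_hamming_graph)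

section \<open>Coordinate operators\<close>

text \<open>View V as a tensor power of the functions on the alphabet. With e the unit vector at the
  letter \<open>x c\<close> and u the sum of the other unit vectors, this is e u^T acting on factor
  c; \<open>coord_raise\<close> is its transpose u e^T.\<close>

definition coord_lower ::
  "('d::finite \<Rightarrow> 'a::finite) \<Rightarrow> 'd \<Rightarrow> complex ^ ('d \<Rightarrow> 'a) \<Rightarrow> complex ^ ('d \<Rightarrow> 'a)" where
  "coord_lower x c v = (\<chi> y. if y c = x c then \<Sum>a\<in>-{x c}. v $ y(c := a) else 0)"

definition coord_raise ::
  "('d::finite \<Rightarrow> 'a::finite) \<Rightarrow> 'd \<Rightarrow> complex ^ ('d \<Rightarrow> 'a) \<Rightarrow> complex ^ ('d \<Rightarrow> 'a)" where
  "coord_raise x c v = (\<chi> y. if y c \<noteq> x c then v $ y(c := x c) else 0)"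

lemma additive_coord_lower: "Modules.additive (coord_lower x c)"
  by unfold_locales (simp add: coord_lower_def Finite_Cartesian_Product.vec_eq_iff sum.distrib)

lemma additive_coord_raise: "Modules.additive (coord_raise x c)"
  by unfold_locales (simp add: coord_raise_def Finite_Cartesian_Product.vec_eq_iff)

lemma coord_lower_commute:
  assumes "c \<noteq> d"
  shows "coord_lower x c (coord_lower x d v) = coord_lower x d (coord_lower x c v)"
  using assms
  by (auto simp: coord_lower_def Finite_Cartesian_Product.vec_eq_iff fun_upd_twist[of c d] intro: sum.swap)

lemma coord_lower_raise_commute:
  assumes "c \<noteq> d"
  shows "coord_lower x c (coord_raise x d v) = coord_raise x d (coord_lower x c v)"
  using assms
  by (auto simp: coord_lower_def coord_raise_def Finite_Cartesian_Product.vec_eq_iff fun_upd_twist[of c d])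

lemma coord_lower_lower [simp]: "coord_lower x c (coord_lower x c v) = 0"
  by (auto simp: coord_lower_def Finite_Cartesian_Product.vec_eq_iff intro!: sum.neutral)

text \<open>Raising copies the value at the letter \<open>x c\<close> to each of the other n - 1
  letters, and the second lowering adds up these equal copies.\<close>

lemma coord_lower_raise_lower:
  fixes x :: "'d::finite \<Rightarrow> 'a::finite"
  shows "coord_lower x c (coord_raise x c (coord_lower x c v)) =
    (of_nat CARD('a) - 1) *s coord_lower x c v"
proof -
  have "card (- {x c}) = CARD('a) - 1"
    by (simp add: Compl_eq_Diff_UNIV)
  moreover have "CARD('a) \<ge> 1"
    by (simp add: Suc_le_eq)
  ultimately have "of_nat (card (- {x c})) = (of_nat CARD('a) - 1 :: complex)"
    by (simp add: of_nat_diff)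
  then show ?thesis
    by (simp add: coord_lower_def coord_raise_def Finite_Cartesian_Product.vec_eq_iff
        left_diff_distrib)
qed

text \<open>The neighbours of y one step farther from x arise exactly once each by choosing a
  coordinate where y agrees with x and a letter different from that of x.\<close>

lemma lowering_hamming_graph_mult:
  fixes x :: "'d::finite \<Rightarrow> 'a::finite"
  shows "lowering CARD('d) hamming_graph x *v v = (\<Sum>c\<in>UNIV. coord_lower x c v)"
  unfolding Finite_Cartesian_Product.vec_eq_iff
proof
  fix y
  let ?S = "SIGMA c:{c. y c = x c}. - {x c}"
  let ?Z = "{z. hamming_graph y z \<and> hdist x z = Suc (hdist x y)}"
  have bij: "bij_betw (\<lambda>(c, a). y(c := a)) ?S ?Z"
  proof (rule bij_betw_imageI)
    show "inj_on (\<lambda>(c, a). y(c := a)) ?S"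
    proof (rule inj_onI)
      fix p q
      assume p: "p \<in> ?S" and q: "q \<in> ?S"
        and eq: "(case p of (c, a) \<Rightarrow> y(c := a)) = (case q of (c, a) \<Rightarrow> y(c := a))"
      \<comment> \<open>At the coordinate changed by p, the common tuple differs from y; hence q
        changes the same coordinate, to the same letter.\<close>
      show "p = q"
        using p q fun_cong[OF eq, of "fst p"] by (auto split: if_splits)
    qed
    show "(\<lambda>(c, a). y(c := a)) ` ?S = ?Z"
    proof (intro equalityI subsetI)
      fix z assume "z \<in> (\<lambda>(c, a). y(c := a)) ` ?S"
      then show "z \<in> ?Z"
        by (auto simp: hdist_upd_eq_Suc) (auto simp: hamming_graph_iff)
    next
      fix z assume "z \<in> ?Z"
      then obtain c a where z: "z = y(c := a)" "a \<noteq> y c"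
        and h: "hdist x z = Suc (hdist x y)" by (auto simp: hamming_graph_iff)
      \<comment> \<open>Changing a coordinate where y already differs from x cannot increase the
        distance.\<close>
      have "y c = x c"
        using hdist_upd_le[of y c x a] h z(1) by (cases "y c = x c") auto
      with z show "z \<in> (\<lambda>(c, a). y(c := a)) ` ?S" by force
    qed
  qed
  have "(lowering CARD('d) hamming_graph x *v v) $ y = (\<Sum>z\<in>?Z. v $ z)"
    by (simp add: lowering_mult_nth gdist_hamming_graph hdist_le_card)
  also have "\<dots> = (\<Sum>(c, a)\<in>?S. v $ y(c := a))"
    using sum.reindex_bij_betw[OF bij, of "\<lambda>z. v $ z"] by (simp add: case_prod_unfold)
  also have "\<dots> = (\<Sum>c | y c = x c. \<Sum>a\<in>-{x c}. v $ y(c := a))"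
    by (simp add: sum.Sigma)
  also have "\<dots> = (\<Sum>c\<in>UNIV. coord_lower x c v) $ y"
    by (simp add: coord_lower_def flip: sum.inter_filter)
  finally show "(lowering CARD('d) hamming_graph x *v v) $ y =
    (\<Sum>c\<in>UNIV. coord_lower x c v) $ y" .
qed

text \<open>The neighbours of y one step closer to x arise exactly once each by resetting a
  differing coordinate to the letter of x.\<close>

lemma raising_hamming_graph_mult:
  fixes x :: "'d::finite \<Rightarrow> 'a::finite"
  shows "raising CARD('d) hamming_graph x *v v = (\<Sum>c\<in>UNIV. coord_raise x c v)"
  unfolding Finite_Cartesian_Product.vec_eq_iff
proof
  fix y
  let ?S = "{c. y c \<noteq> x c}"
  let ?Z = "{z. hamming_graph y z \<and> hdist x y = Suc (hdist x z)}"
  have bij: "bij_betw (\<lambda>c. y(c := x c)) ?S ?Z"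
  proof (rule bij_betw_imageI)
    show "inj_on (\<lambda>c. y(c := x c)) ?S"
    proof (rule inj_onI, clarify)
      fix c d
      assume ne: "y c \<noteq> x c" "y d \<noteq> x d" and eq: "y(c := x c) = y(d := x d)"
      show "c = d"
        using ne fun_cong[OF eq, of c] by (auto split: if_splits)
    qed
    show "(\<lambda>c. y(c := x c)) ` ?S = ?Z"
    proof (intro equalityI subsetI)
      fix z assume "z \<in> (\<lambda>c. y(c := x c)) ` ?S"
      then obtain c where c: "y c \<noteq> x c" "z = y(c := x c)" by blast
      then have "hamming_graph y z"
        unfolding hamming_graph_iff by metis
      with c hdist_upd_self[of y c x] show "z \<in> ?Z" by simp
    next
      fix z assume "z \<in> ?Z"
      then obtain c a where z: "z = y(c := a)" "a \<noteq> y c"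
        and h: "hdist x y = Suc (hdist x z)" by (auto simp: hamming_graph_iff)
      \<comment> \<open>Writing a letter other than \<open>x c\<close> at coordinate c cannot
        decrease the distance.\<close>
      have "a = x c"
        using hdist_le_upd[of a x c y] h z(1) by (cases "a = x c") auto
      with z show "z \<in> (\<lambda>c. y(c := x c)) ` ?S" by force
    qed
  qed
  have "(raising CARD('d) hamming_graph x *v v) $ y = (\<Sum>z\<in>?Z. v $ z)"
    by (simp add: raising_mult_nth gdist_hamming_graph hdist_le_card)
  also have "\<dots> = (\<Sum>c\<in>?S. v $ y(c := x c))"
    using sum.reindex_bij_betw[OF bij, of "\<lambda>z. v $ z"] by simp
  also have "\<dots> = (\<Sum>c\<in>UNIV. coord_raise x c v) $ y"
    by (simp add: coord_raise_def flip: sum.inter_filter)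
  finally show "(raising CARD('d) hamming_graph x *v v) $ y =
    (\<Sum>c\<in>UNIV. coord_raise x c v) $ y" .
qed

section \<open>Commutators of sums of coordinate operators, and the cubic identity\<close>

lemma commutator_sum:
  fixes f g :: "'i::finite \<Rightarrow> 'b::ab_group_add \<Rightarrow> 'b"
  assumes f: "\<And>c. Modules.additive (f c)" and g: "\<And>c. Modules.additive (g c)"
    and comm: "\<And>c d v. c \<noteq> d \<Longrightarrow> f c (g d v) = g d (f c v)"
  shows "(\<Sum>c\<in>UNIV. f c (\<Sum>d\<in>UNIV. g d v)) - (\<Sum>d\<in>UNIV. g d (\<Sum>c\<in>UNIV. f c v)) =
    (\<Sum>c\<in>UNIV. f c (g c v) - g c (f c v))"
proof -
  have "(\<Sum>c\<in>UNIV. f c (\<Sum>d\<in>UNIV. g d v)) - (\<Sum>d\<in>UNIV. g d (\<Sum>c\<in>UNIV. f c v)) =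
      (\<Sum>c\<in>UNIV. \<Sum>d\<in>UNIV. f c (g d v)) - (\<Sum>d\<in>UNIV. \<Sum>c\<in>UNIV. g d (f c v))"
    by (simp add: additive.sum[OF f] additive.sum[OF g])
  also have "\<dots> = (\<Sum>c\<in>UNIV. \<Sum>d\<in>UNIV. f c (g d v) - g d (f c v))"
    by (subst (2) sum.swap) (simp add: sum_subtractf)
  \<comment> \<open>Commutation at distinct coordinates kills the off-diagonal terms of the double
    sum.\<close>
  also have "\<dots> = (\<Sum>c\<in>UNIV. \<Sum>d\<in>UNIV. if c = d then f c (g c v) - g c (f c v) else 0)"
    by (intro sum.cong) (auto simp: comm)
  finally show ?thesis by simp
qed

lemma hamming_lowering_raising_identity:
  fixes x :: "'d::finite \<Rightarrow> 'a::finite"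
  defines "L \<equiv> lowering CARD('d) hamming_graph x"
    and "R \<equiv> raising CARD('d) hamming_graph x"
  shows "(- 1 / 2) *s (R *v (L *v (L *v v))) + L *v (R *v (L *v v))
    + (- 1 / 2) *s (L *v (L *v (R *v v))) = (of_nat CARD('a) - 1) *s (L *v v)"
proof -
  let ?l = "coord_lower x" and ?r = "coord_raise x"
  \<comment> \<open>\<open>h c\<close> is the commutator of the two operators at coordinate c, and
    \<open>H\<close> turns out to be the commutator [L, R].\<close>
  define h where "h c w = ?l c (?r c w) - ?r c (?l c w)" for c w
  define H where "H w = (\<Sum>c\<in>UNIV. h c w)" for w
  have L: "L *v w = (\<Sum>c\<in>UNIV. ?l c w)" and R: "R *v w = (\<Sum>c\<in>UNIV. ?r c w)" for w
    unfolding L_def R_def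
    by (rule lowering_hamming_graph_mult raising_hamming_graph_mult)+
  note add_simps = additive.add[OF additive_coord_lower] additive.add[OF additive_coord_raise]
    additive.diff[OF additive_coord_lower] additive.diff[OF additive_coord_raise]
  have h_additive: "Modules.additive (h c)" for c
    by unfold_locales (simp add: h_def add_simps)
  \<comment> \<open>Since \<open>h d\<close> is built from operators at d alone, it commutes with
    lowering at c, so \<open>commutator_sum\<close> can be applied a second time.\<close>
  have h_comm: "?l c (h d w) = h d (?l c w)" if "c \<noteq> d" for c d w
    using that
    by (simp add: h_def add_simps coord_lower_raise_commute[of c d] coord_lower_commute[of c d])
  have LR: "L *v (R *v w) - R *v (L *v w) = H w" for w
    unfolding L R H_def h_def
    by (rule commutator_sum)
       (auto simp: additive_coord_lower additive_coord_raise coord_lower_raise_commute)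
  have "L *v H v - H (L *v v) = (\<Sum>c\<in>UNIV. ?l c (h c v) - h c (?l c v))"
    unfolding L H_def
    by (rule commutator_sum) (auto simp: additive_coord_lower h_additive h_comm)
  also have "\<dots> = (\<Sum>c\<in>UNIV. (- 2 * (of_nat CARD('a) - 1)) *s ?l c v)"
  proof (intro sum.cong refl)
    fix c
    \<comment> \<open>In the local double commutator l l r - 2 l r l + r l l the outer terms vanish
      because l l = 0. For r l l this requires that r maps 0 to 0; the middle term gives the factor
      -2 (n - 1).\<close>
    have "?r c 0 = 0"
      by (rule additive.zero[OF additive_coord_raise])
    then show "?l c (h c v) - h c (?l c v) = (- 2 * (of_nat CARD('a) - 1)) *s ?l c v"
      by (simp add: h_def add_simps coord_lower_raise_lower)
         (simp add: Finite_Cartesian_Product.vec_eq_iff algebra_simps)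
  qed
  also have "\<dots> = (- 2 * (of_nat CARD('a) - 1)) *s (L *v v)"
    unfolding L Finite_Cartesian_Product.vec_eq_iff
    by (simp only: sum_component vector_smult_component sum_distrib_left simp_thms)
  finally have "L *v (L *v (R *v v)) - L *v (R *v (L *v v))
      - (L *v (R *v (L *v v)) - R *v (L *v (L *v v))) =
      (- 2 * (of_nat CARD('a) - 1)) *s (L *v v)"
    by (simp flip: LR add: matrix_vector_mult_diff_distrib)
  then show ?thesis
    unfolding Finite_Cartesian_Product.vec_eq_iff by (simp add: algebra_simps) (auto simp: field_simps)
qed

section \<open>The parameter matrix\<close>

text \<open>Half the Cartan matrix of type A, written as an infinite Toeplitz matrix, so that one
  function serves all sizes and all principal submatrices.\<close>

definition half_tridiagonal :: "nat \<Rightarrow> nat \<Rightarrow> complex" where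
  "half_tridiagonal i j = (if i = j then 1 else if i = j + 1 \<or> j = i + 1 then - 1 / 2 else 0)"

text \<open>A kernel vector, extended by zero, satisfies \<open>w\<^sub>i\<^sub>-\<^sub>1 + w\<^sub>i\<^sub>+\<^sub>1 = 2 w\<^sub>i\<close> and hence is the arithmetic
  progression \<open>w\<^sub>i = (i + 1) w\<^sub>0\<close>, which never returns to zero unless it vanishes.\<close>

lemma det_half_tridiagonal_nonzero:
  "Determinant.det (Matrix.mat k k (\<lambda>(i, j). half_tridiagonal i j)) \<noteq> 0"
proof
  let ?A = "Matrix.mat k k (\<lambda>(i, j). half_tridiagonal i j)"
  assume "Determinant.det ?A = 0"
  then obtain v where v: "v \<in> carrier_vec k" "v \<noteq> 0\<^sub>v k" "?A *\<^sub>v v = 0\<^sub>v k"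
    using det_0_iff_vec_prod_zero[of ?A k] by auto
  \<comment> \<open>The extension by zero lets the last row obey the same recurrence as the others
    and provides the end condition \<open>w k = 0\<close>.\<close>
  define w where "w j = (if j < k then vec_index v j else 0)" for j
  have rec: "w (Suc i) = 2 * w i - (if i = 0 then 0 else w (i - 1))" if "i < k" for i
  proof -
    have "0 = vec_index (?A *\<^sub>v v) i"
      using v that by simp
    also have "\<dots> = (\<Sum>j\<in>{0..<k}. half_tridiagonal i j * vec_index v j)"
      using v(1) that by (simp add: scalar_prod_def)
    \<comment> \<open>At most three columns contribute. For i = 0 the truncated index
      \<open>i - 1\<close> coincides with i, hence the guard; for i = k - 1 the column
      \<open>Suc i\<close> is out of range, where w is 0.\<close>
    also have "\<dots> = (\<Sum>j\<in>{0..<k}. (if j = i then w i else 0)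
        + (if j = Suc i then - w (Suc i) / 2 else 0)
        + (if j = i - 1 then (if i = 0 then 0 else - w (i - 1) / 2) else 0))"
      by (intro sum.cong) (auto simp: half_tridiagonal_def w_def)
    also have "\<dots> = w i - w (Suc i) / 2 - (if i = 0 then 0 else w (i - 1) / 2)"
      using that by (simp add: sum.distrib w_def)
    finally show ?thesis
      by (simp add: field_simps split: if_splits)
  qed
  have lin: "w i = of_nat (Suc i) * w 0" if "i \<le> k" for i
    using that
  proof (induction i rule: less_induct)
    case (less i)
    show ?case
    proof (cases i)
      case 0
      then show ?thesis by simp
    next
      case (Suc m)
      show ?thesis
      proof (cases m)
        case 0
        then show ?thesis using rec[of 0] Suc less.prems by simp
      next
        case (Suc l)
        then show ?thesis
          using rec[of m] less.IH[of m] less.IH[of l] \<open>i = Suc m\<close> less.prems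
          by (simp add: algebra_simps)
      qed
    qed
  qed
  \<comment> \<open>The progression gives (k + 1) times \<open>w 0\<close> at the same place, and k
    + 1 is nonzero.\<close>
  have "w k = 0" by (simp add: w_def)
  with lin[of k] have "w 0 = 0"
    by (metis le_refl mult_eq_0_iff of_nat_eq_0_iff nat.distinct(1))
  then have "vec_index v i = 0" if "i < k" for i
    using lin[of i] that by (simp add: w_def)
  then have "v = 0\<^sub>v k"
    using v(1) by (intro eq_vecI) auto
  with v(2) show False by simp
qed

text \<open>The entries depend only on the difference of the indices, so shifting a principal
  submatrix to start at index 0 leaves its entries unchanged and the determinant lemma
  applies.\<close>

lemma parameter_matrix_half_tridiagonal: "parameter_matrix D half_tridiagonal"
proof -
  have "principal_submatrix half_tridiagonal s t =
      Matrix.mat (t + 1 - s) (t + 1 - s) (\<lambda>(i, j). half_tridiagonal i j)" for s t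
    unfolding principal_submatrix_def by (rule cong_mat) (auto simp: half_tridiagonal_def)
  then show ?thesis
    unfolding parameter_matrix_def
    using det_half_tridiagonal_nonzero by (auto simp: half_tridiagonal_def)
qed

section \<open>The strongly uniform structure of the Hamming graph\<close>

lemma e_minus_half_tridiagonal: "i \<ge> 2 \<Longrightarrow> e_minus half_tridiagonal i = - 1 / 2"
  by (simp add: e_minus_def half_tridiagonal_def)

lemma e_plus_half_tridiagonal: "i < D \<Longrightarrow> e_plus D half_tridiagonal i = - 1 / 2"
  by (simp add: e_plus_def half_tridiagonal_def)

lemma strongly_uniform_structure_hamming_graph:
  fixes x :: "'d::finite \<Rightarrow> 'a::finite"
  assumes "CARD('a) \<ge> 2"
  shows "strongly_uniform_structure hamming_graph x half_tridiagonal
    (\<lambda>_. of_nat CARD('a) - 1)"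
proof -
  let ?D = "CARD('d)"
  let ?L = "lowering ?D hamming_graph x" and ?R = "raising ?D hamming_graph x"
  note diam = gdiam_hamming_graph[where 'd = 'd, OF assms]
  have le: "gdist hamming_graph x y \<le> ?D" for y
    by (simp add: gdist_hamming_graph hdist_le_card)
  \<comment> \<open>The required equation differs from the identity on V only in the end
    coefficients, which are 0 instead of -1/2; in each such case the term concerned vanishes on the
    layer in question.\<close>
  have "e_minus half_tridiagonal i *s (?R *v (?L *v (?L *v v))) + ?L *v (?R *v (?L *v v))
      + e_plus ?D half_tridiagonal i *s (?L *v (?L *v (?R *v v))) =
      (of_nat CARD('a) - 1) *s (?L *v v)"
    if i: "i \<in> {1..?D}" and v: "v \<in> EstarV hamming_graph x i" for i v
  proof -
    have "e_minus half_tridiagonal i *s (?R *v (?L *v (?L *v v))) =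
        (- 1 / 2) *s (?R *v (?L *v (?L *v v)))"
    proof (cases "i = 1")
      case True
      then have "?L *v (?L *v v) = 0"
        using lowering_lowering_EstarV_1[OF le] v by simp
      then show ?thesis by simp
    next
      case False
      then show ?thesis using i by (simp add: e_minus_half_tridiagonal)
    qed
    moreover have "e_plus ?D half_tridiagonal i *s (?L *v (?L *v (?R *v v))) =
        (- 1 / 2) *s (?L *v (?L *v (?R *v v)))"
    proof (cases "i = ?D")
      case True
      then have "?R *v v = 0"
        using raising_EstarV_top[OF le] v by simp
      then show ?thesis by simp
    next
      case False
      then show ?thesis using i by (simp add: e_plus_half_tridiagonal)
    qed
    ultimately show ?thesis
      using hamming_lowering_raising_identity[of x v] by simp
  qed
  \<comment> \<open>The definition speaks about \<open>graph_f\<close>; its L, R and layers are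
    rewritten to those of the Hamming graph itself, and matrix products become iterated
    applications.\<close>
  then have "uniform_structure hamming_graph x half_tridiagonal (\<lambda>_. of_nat CARD('a) - 1)"
    unfolding uniform_structure_def Let_def diam lowering_graph_f_hamming_graph
      raising_graph_f_hamming_graph EstarV_graph_f_hamming_graph
    by (simp add: parameter_matrix_half_tridiagonal flip: matrix_vector_mul_assoc)
  then show ?thesis
    unfolding strongly_uniform_structure_def diam
    by (auto simp: e_minus_half_tridiagonal e_plus_half_tridiagonal)
qed

theorem theorem9p5:
  fixes D n :: nat
    and x :: "'d::finite \<Rightarrow> 'a::finite"
    and \<Gamma> :: "('d \<Rightarrow> 'a) graph"
    and L R :: "('d \<Rightarrow> 'a) cmatrix"
  assumes "CARD('d) = D" and "CARD('a) = n"
    and "D \<ge> 3" and "n \<ge> 3"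
  defines "\<Gamma> \<equiv> hamming_graph"
    and "L \<equiv> lowering D \<Gamma> x"
    and "R \<equiv> raising D \<Gamma> x"
  shows "(\<forall>i\<in>{1..D}. \<forall>v\<in>EstarV \<Gamma> x i.
            (- 1 / 2) *s ((R ** L ** L) *v v) + (L ** R ** L) *v v
              + (- 1 / 2) *s ((L ** L ** R) *v v) = (of_nat n - 1) *s (L *v v))
       \<and> supports_strongly_uniform \<Gamma> x
       \<and> (\<exists>U f. strongly_uniform_structure \<Gamma> x U f
            \<and> (\<forall>i\<in>{2..D}. e_minus U i = - 1 / 2)
            \<and> (\<forall>i\<in>{1..D - 1}. e_plus D U i = - 1 / 2)
            \<and> (\<forall>i\<in>{1..D}. f i = of_nat n - 1))"
proof -
  \<comment> \<open>The lower bound on n supplies two distinct letters, which make the diameter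
    equal to D.\<close>
  have su: "strongly_uniform_structure \<Gamma> x half_tridiagonal (\<lambda>_. of_nat n - 1)"
    using strongly_uniform_structure_hamming_graph[of x] assms(2,4) by (simp add: \<Gamma>_def)
  have "(- 1 / 2) *s ((R ** L ** L) *v v) + (L ** R ** L) *v v
      + (- 1 / 2) *s ((L ** L ** R) *v v) = (of_nat n - 1) *s (L *v v)" for v
    using hamming_lowering_raising_identity[of x v]
    unfolding L_def R_def \<Gamma>_def assms(1,2) by (simp flip: matrix_vector_mul_assoc)
  moreover have "\<forall>i\<in>{2..D}. e_minus half_tridiagonal i = - 1 / 2"
    "\<forall>i\<in>{1..D - 1}. e_plus D half_tridiagonal i = - 1 / 2"
    by (auto simp: e_minus_half_tridiagonal e_plus_half_tridiagonal)
  ultimately show ?thesis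
    unfolding supports_strongly_uniform_def using su by blast
qed

end
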